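(* Let $\mathcal{X}$ denote the complex vector space $\ell_2(\mathbb{Z})$ equipped with the norm $$\|x\|_* = \max\Big\{\Big(\sum_{k \in \mathbb{Z}\setminus\{0,1\}} |x_k|^2\Big)^{1/2},\ |x_1|\Big\} + |x_0|, \qquad x = (x_k)_{k\in\mathbb{Z}}.$$ Then there exists an invertible bounded linear operator $B : \mathcal{X} \to \mathcal{X}$ such that $\|(B-\lambda I)^{-1}\|$ is constant in a neighbourhood of $\lambda = 0$, i.e. there is an open neighbourhood of $0$ in $\mathbb{C}$ that is contained in the resolvent set of $B$ and on which the function $\lambda \mapsto \|(B-\lambda I)^{-1}\|$ is constant.
   Context: The norm $\|\cdot\|_*$ is equivalent to the usual norm of $\ell_2(\mathbb{Z})$, so $\mathcal{X}$ is a Banach space. The norm $\|(B-\lambda I)^{-1}\|$ is the operator norm on $\mathcal{X}$ induced by $\|\cdot\|_*$. *)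

theory Defs
  imports "HOL-Analysis.Analysis"
begin

typedef l2_star =
  "{x :: int \<Rightarrow> complex. (\<lambda>k. (cmod (x k))\<^sup>2) summable_on UNIV}"
  morphisms coord Abs_l2_star
  by (rule exI[of _ "\<lambda>_. 0"]) simp

setup_lifting type_definition_l2_star

lemma square_summable_add:
  fixes x y :: "int \<Rightarrow> complex"
  assumes "(\<lambda>k. (cmod (x k))\<^sup>2) summable_on A" "(\<lambda>k. (cmod (y k))\<^sup>2) summable_on A"
  shows "(\<lambda>k. (cmod (x k + y k))\<^sup>2) summable_on A"
proof (rule summable_on_comparison_test)
  show "(\<lambda>k. 2 * (cmod (x k))\<^sup>2 + 2 * (cmod (y k))\<^sup>2) summable_on A"
    using assms by (intro summable_on_add summable_on_cmult_right)
next
  fix k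
  have "(cmod (x k + y k))\<^sup>2 \<le> (cmod (x k) + cmod (y k))\<^sup>2"
    by (intro power_mono norm_triangle_ineq) simp
  also have "\<dots> \<le> 2 * (cmod (x k))\<^sup>2 + 2 * (cmod (y k))\<^sup>2"
    using zero_le_power2[of "cmod (x k) - cmod (y k)"]
    by (simp add: power2_eq_square algebra_simps)
  finally show "(cmod (x k + y k))\<^sup>2 \<le> 2 * (cmod (x k))\<^sup>2 + 2 * (cmod (y k))\<^sup>2" .
qed simp

lemma square_summable_mult:
  fixes x :: "int \<Rightarrow> complex"
  assumes "(\<lambda>k. (cmod (x k))\<^sup>2) summable_on A"
  shows "(\<lambda>k. (cmod (c * x k))\<^sup>2) summable_on A"
  using summable_on_cmult_right[OF assms, of "(cmod c)\<^sup>2"]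
  by (simp add: norm_mult power_mult_distrib)

lift_definition scaleC :: "complex \<Rightarrow> l2_star \<Rightarrow> l2_star" (infixr "*\<^sub>C" 75)
  is "\<lambda>c x k. c * x k"
  by (rule square_summable_mult)

instantiation l2_star :: real_vector
begin

lift_definition zero_l2_star :: l2_star is "\<lambda>_. 0" by simp
lift_definition plus_l2_star :: "l2_star \<Rightarrow> l2_star \<Rightarrow> l2_star" is "\<lambda>x y k. x k + y k"
  by (rule square_summable_add)
lift_definition uminus_l2_star :: "l2_star \<Rightarrow> l2_star" is "\<lambda>x k. - x k" by simp
lift_definition minus_l2_star :: "l2_star \<Rightarrow> l2_star \<Rightarrow> l2_star" is "\<lambda>x y k. x k - y k"
  subgoal for x y using square_summable_add[of x UNIV "\<lambda>k. - y k"] by simp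
  done
definition scaleR_l2_star :: "real \<Rightarrow> l2_star \<Rightarrow> l2_star"
  where "scaleR_l2_star r x = of_real r *\<^sub>C x"

instance
  by standard (simp_all add: scaleR_l2_star_def, (transfer; simp add: fun_eq_iff algebra_simps)+)

end

lemma coord_simps [simp]:
  "coord 0 k = 0" "coord (x + y) k = coord x k + coord y k"
  "coord (x - y) k = coord x k - coord y k" "coord (- x) k = - coord x k"
  "coord (c *\<^sub>C x) k = c * coord x k" "coord (r *\<^sub>R x) k = of_real r * coord x k"
  by (simp_all add: scaleR_l2_star_def zero_l2_star.rep_eq plus_l2_star.rep_eq
        minus_l2_star.rep_eq uminus_l2_star.rep_eq scaleC.rep_eq)

lemma l2_star_eqI: "(\<And>k. coord x k = coord y k) \<Longrightarrow> x = y"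
  by (metis coord_inject ext)

lemma summable_coord: "(\<lambda>k. (cmod (coord x k))\<^sup>2) summable_on A"
  using coord[of x] summable_on_subset_banach by blast

lemma L2_set_le_infsum:
  assumes "finite F" "F \<subseteq> A"
  shows "L2_set (\<lambda>k. cmod (coord x k)) F \<le> sqrt (\<Sum>\<^sub>\<infinity>k\<in>A. (cmod (coord x k))\<^sup>2)"
  unfolding L2_set_def
  by (intro real_sqrt_le_mono finite_sum_le_infsum summable_coord assms) simp

lemma sqrt_infsum_le:
  assumes "\<And>F. finite F \<Longrightarrow> F \<subseteq> A \<Longrightarrow> L2_set (\<lambda>k. cmod (coord x k)) F \<le> b"
  shows "sqrt (\<Sum>\<^sub>\<infinity>k\<in>A. (cmod (coord x k))\<^sup>2) \<le> b"
proof -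
  have b: "0 \<le> b" using assms[of "{}"] by simp
  have "(\<Sum>\<^sub>\<infinity>k\<in>A. (cmod (coord x k))\<^sup>2) \<le> b\<^sup>2"
  proof (rule infsum_le_finite_sums[OF summable_coord])
    fix F assume "finite F" "F \<subseteq> A"
    from assms[OF this] show "(\<Sum>k\<in>F. (cmod (coord x k))\<^sup>2) \<le> b\<^sup>2"
      by (simp add: L2_set_def sqrt_le_D)
  qed
  then show ?thesis using b by (simp add: real_le_lsqrt infsum_nonneg)
qed

lemma sqrt_infsum_triangle:
  "sqrt (\<Sum>\<^sub>\<infinity>k\<in>A. (cmod (coord (x + y) k))\<^sup>2)
     \<le> sqrt (\<Sum>\<^sub>\<infinity>k\<in>A. (cmod (coord x k))\<^sup>2) + sqrt (\<Sum>\<^sub>\<infinity>k\<in>A. (cmod (coord y k))\<^sup>2)"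
proof (rule sqrt_infsum_le)
  fix F :: "int set" assume F: "finite F" "F \<subseteq> A"
  have "L2_set (\<lambda>k. cmod (coord (x + y) k)) F
          \<le> L2_set (\<lambda>k. cmod (coord x k) + cmod (coord y k)) F"
    by (rule L2_set_mono) (simp_all add: norm_triangle_ineq)
  also have "\<dots> \<le> L2_set (\<lambda>k. cmod (coord x k)) F + L2_set (\<lambda>k. cmod (coord y k)) F"
    by (rule L2_set_triangle_ineq)
  also have "\<dots> \<le> sqrt (\<Sum>\<^sub>\<infinity>k\<in>A. (cmod (coord x k))\<^sup>2) + sqrt (\<Sum>\<^sub>\<infinity>k\<in>A. (cmod (coord y k))\<^sup>2)"
    by (intro add_mono L2_set_le_infsum F)
  finally show "L2_set (\<lambda>k. cmod (coord (x + y) k)) F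
     \<le> sqrt (\<Sum>\<^sub>\<infinity>k\<in>A. (cmod (coord x k))\<^sup>2) + sqrt (\<Sum>\<^sub>\<infinity>k\<in>A. (cmod (coord y k))\<^sup>2)" .
qed

lemma sqrt_infsum_scaleC:
  "sqrt (\<Sum>\<^sub>\<infinity>k\<in>A. (cmod (coord (c *\<^sub>C x) k))\<^sup>2)
     = cmod c * sqrt (\<Sum>\<^sub>\<infinity>k\<in>A. (cmod (coord x k))\<^sup>2)"
  by (simp add: norm_mult power_mult_distrib infsum_cmult_right' real_sqrt_mult)

lemma coord_le_sqrt_infsum:
  assumes "k \<in> A"
  shows "cmod (coord x k) \<le> sqrt (\<Sum>\<^sub>\<infinity>k\<in>A. (cmod (coord x k))\<^sup>2)"
  using L2_set_le_infsum[of "{k}" A x] assms by simp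

instantiation l2_star :: real_normed_vector
begin

definition norm_l2_star :: "l2_star \<Rightarrow> real" where
  "norm_l2_star x =
     max (sqrt (\<Sum>\<^sub>\<infinity>k\<in>- {0, 1}. (cmod (coord x k))\<^sup>2)) (cmod (coord x 1)) + cmod (coord x 0)"

definition dist_l2_star :: "l2_star \<Rightarrow> l2_star \<Rightarrow> real"
  where "dist_l2_star x y = norm (x - y)"

definition sgn_l2_star :: "l2_star \<Rightarrow> l2_star"
  where "sgn_l2_star x = x /\<^sub>R norm x"

definition uniformity_l2_star :: "(l2_star \<times> l2_star) filter"
  where "uniformity_l2_star = (INF e\<in>{0<..}. principal {(x, y). dist x y < e})"

definition open_l2_star :: "l2_star set \<Rightarrow> bool"
  where "open_l2_star U = (\<forall>x\<in>U. eventually (\<lambda>(x', y). x' = x \<longrightarrow> y \<in> U) uniformity)"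

instance
proof
  fix x y :: l2_star and a :: real
  show "(norm x = 0) = (x = 0)"
  proof
    assume n: "norm x = 0"
    have nn: "0 \<le> sqrt (\<Sum>\<^sub>\<infinity>k\<in>- {0, 1}. (cmod (coord x k))\<^sup>2)"
      by (simp add: infsum_nonneg)
    have 0: "cmod (coord x 0) = 0" and 1: "cmod (coord x 1) = 0"
      and r: "sqrt (\<Sum>\<^sub>\<infinity>k\<in>- {0, 1}. (cmod (coord x k))\<^sup>2) = 0"
      using n nn norm_ge_zero[of "coord x 0"] norm_ge_zero[of "coord x 1"]
      unfolding norm_l2_star_def by linarith+
    show "x = 0"
    proof (rule l2_star_eqI)
      fix k
      show "coord x k = coord 0 k"
        using 0 1 r coord_le_sqrt_infsum[of k "- {0, 1}" x] by (cases "k \<in> {0, 1}") auto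
    qed
  qed (simp add: norm_l2_star_def)
  show "norm (x + y) \<le> norm x + norm y"
    using sqrt_infsum_triangle[of x y "- {0, 1}"]
      norm_triangle_ineq[of "coord x 0" "coord y 0"] norm_triangle_ineq[of "coord x 1" "coord y 1"]
    unfolding norm_l2_star_def coord_simps by linarith
  show "norm (a *\<^sub>R x) = \<bar>a\<bar> * norm x"
    unfolding scaleR_l2_star_def norm_l2_star_def sqrt_infsum_scaleC
    by (simp add: norm_mult max_mult_distrib_left distrib_left)
qed (rule dist_l2_star_def sgn_l2_star_def uniformity_l2_star_def open_l2_star_def)+

end

lemma norm_scaleC: "norm (c *\<^sub>C x) = cmod c * norm x"
  unfolding norm_l2_star_def sqrt_infsum_scaleC
  by (simp add: norm_mult max_mult_distrib_left distrib_left)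

lemma coord_le_norm: "cmod (coord x k) \<le> norm x"
proof -
  let ?s = "sqrt (\<Sum>\<^sub>\<infinity>k\<in>- {0, 1}. (cmod (coord x k))\<^sup>2)"
  have s0: "0 \<le> ?s" by (simp add: infsum_nonneg)
  consider "k = 0" | "k = 1" | "k \<in> - {0, 1}" by blast
  then have "cmod (coord x k) \<le> max ?s (cmod (coord x 1)) + cmod (coord x 0)"
  proof cases
    case 3
    from coord_le_sqrt_infsum[OF this, of x] show ?thesis
      using norm_ge_zero[of "coord x 0"] by linarith
  qed (use s0 norm_ge_zero[of "coord x 0"] in \<open>hypsubst, linarith\<close>)+
  then show ?thesis by (simp only: norm_l2_star_def)
qed

text \<open>Equivalence with the usual norm of \<open>\<ell>\<^sub>2\<close>.\<close>

lemma norm_le_usual: "norm x \<le> 2 * sqrt (\<Sum>\<^sub>\<infinity>k. (cmod (coord x k))\<^sup>2)"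
proof -
  have "sqrt (\<Sum>\<^sub>\<infinity>k\<in>- {0, 1}. (cmod (coord x k))\<^sup>2) \<le> sqrt (\<Sum>\<^sub>\<infinity>k. (cmod (coord x k))\<^sup>2)"
    by (rule sqrt_infsum_le) (rule L2_set_le_infsum, auto)
  then show ?thesis
    using coord_le_sqrt_infsum[of 0 UNIV x] coord_le_sqrt_infsum[of 1 UNIV x]
    unfolding norm_l2_star_def by (simp del: real_sqrt_le_iff)
qed

lemma usual_le_norm: "sqrt (\<Sum>\<^sub>\<infinity>k. (cmod (coord x k))\<^sup>2) \<le> 2 * norm x"
proof -
  let ?f = "\<lambda>k. (cmod (coord x k))\<^sup>2"
  let ?s = "sqrt (infsum ?f (- {0, 1}))"
  have s0: "0 \<le> ?s" by (simp add: infsum_nonneg)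
  have "infsum ?f UNIV = infsum ?f ({0, 1} \<union> - {0, 1})" by simp
  also have "\<dots> = infsum ?f {0, 1} + infsum ?f (- {0, 1})"
    by (rule infsum_Un_disjoint[OF summable_coord summable_coord]) auto
  also have "\<dots> = (cmod (coord x 0))\<^sup>2 + (cmod (coord x 1))\<^sup>2 + ?s\<^sup>2"
    by (simp add: infsum_nonneg)
  also have "\<dots> \<le> (norm x)\<^sup>2 + (norm x)\<^sup>2 + (norm x)\<^sup>2"
  proof (intro add_mono power_mono coord_le_norm)
    show "?s \<le> norm x"
      using norm_ge_zero[of "coord x 0"] unfolding norm_l2_star_def by linarith
  qed (use s0 in simp_all)
  also have "\<dots> \<le> (2 * norm x)\<^sup>2" by (simp add: power_mult_distrib)
  finally show ?thesis by (simp add: real_le_lsqrt infsum_nonneg)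
qed

instance l2_star :: banach
proof
  fix X :: "nat \<Rightarrow> l2_star"
  assume X: "Cauchy X"
  have "Cauchy (\<lambda>n. coord (X n) k)" for k
  proof (rule metric_CauchyI)
    fix e :: real assume "0 < e"
    then obtain M where M: "\<And>m n. m \<ge> M \<Longrightarrow> n \<ge> M \<Longrightarrow> dist (X m) (X n) < e"
      using X unfolding Cauchy_def by blast
    have "dist (coord (X m) k) (coord (X n) k) < e" if "m \<ge> M" "n \<ge> M" for m n
      using M[OF that] coord_le_norm[of "X m - X n" k] by (simp add: dist_norm)
    then show "\<exists>M. \<forall>m\<ge>M. \<forall>n\<ge>M. dist (coord (X m) k) (coord (X n) k) < e" by blast
  qed
  then obtain l where l: "\<And>k. (\<lambda>n. coord (X n) k) \<longlonglongrightarrow> l k"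
    unfolding Cauchy_convergent_iff convergent_def by metis
  have fin: "L2_set (\<lambda>k. cmod (coord x k)) F \<le> 2 * norm x" if "finite F" for x F
    using L2_set_le_infsum[OF that, of UNIV x] usual_le_norm[of x] by simp
  have tail: "\<exists>M. \<forall>n\<ge>M. \<forall>F. finite F \<longrightarrow> L2_set (\<lambda>k. cmod (coord (X n) k - l k)) F \<le> e"
    if "0 < e" for e :: real
  proof -
    obtain M where M: "\<And>m n. m \<ge> M \<Longrightarrow> n \<ge> M \<Longrightarrow> dist (X m) (X n) < e / 2"
      using X \<open>0 < e\<close> unfolding Cauchy_def by (meson half_gt_zero)
    have "L2_set (\<lambda>k. cmod (coord (X n) k - l k)) F \<le> e" if "n \<ge> M" "finite F" for n F
    proof (rule tendsto_upperbound)
      show "(\<lambda>m. L2_set (\<lambda>k. cmod (coord (X n) k - coord (X m) k)) F)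
              \<longlonglongrightarrow> L2_set (\<lambda>k. cmod (coord (X n) k - l k)) F"
        unfolding L2_set_def by (intro tendsto_intros l)
      show "\<forall>\<^sub>F m in sequentially. L2_set (\<lambda>k. cmod (coord (X n) k - coord (X m) k)) F \<le> e"
      proof (rule eventually_sequentiallyI)
        fix m assume "M \<le> m"
        then show "L2_set (\<lambda>k. cmod (coord (X n) k - coord (X m) k)) F \<le> e"
          using M[of n m] \<open>n \<ge> M\<close> fin[OF \<open>finite F\<close>, of "X n - X m"] by (simp add: dist_norm)
      qed
    qed simp
    then show ?thesis by blast
  qed
  obtain N where N: "\<And>F. finite F \<Longrightarrow> L2_set (\<lambda>k. cmod (coord (X N) k - l k)) F \<le> 1"
    using tail[of 1] by auto
  have sm: "(\<lambda>k. (cmod (coord (X N) k - l k))\<^sup>2) summable_on UNIV"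
  proof (rule nonneg_bdd_above_summable_on)
    show "bdd_above (sum (\<lambda>k. (cmod (coord (X N) k - l k))\<^sup>2) ` {F. F \<subseteq> UNIV \<and> finite F})"
    proof (rule bdd_aboveI2)
      fix F :: "int set" assume "F \<in> {F. F \<subseteq> UNIV \<and> finite F}"
      then show "(\<Sum>k\<in>F. (cmod (coord (X N) k - l k))\<^sup>2) \<le> 1"
        using N[of F] by (simp add: L2_set_def)
    qed
  qed simp
  then have "(\<lambda>k. (cmod (l k - coord (X N) k))\<^sup>2) summable_on UNIV"
    by (simp add: norm_minus_commute)
  from square_summable_add[OF this summable_coord[of "X N"]]
  have "(\<lambda>k. (cmod (l k))\<^sup>2) summable_on UNIV" by simp
  then have cl: "coord (Abs_l2_star l) = l" by (simp add: Abs_l2_star_inverse)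
  have "X \<longlonglongrightarrow> Abs_l2_star l"
  proof (rule metric_LIMSEQ_I)
    fix r :: real assume "0 < r"
    then obtain M where M: "\<And>n F. n \<ge> M \<Longrightarrow> finite F
        \<Longrightarrow> L2_set (\<lambda>k. cmod (coord (X n) k - l k)) F \<le> r / 4"
      using tail[of "r / 4"] by auto
    have "dist (X n) (Abs_l2_star l) < r" if "n \<ge> M" for n
    proof -
      have "sqrt (\<Sum>\<^sub>\<infinity>k. (cmod (coord (X n - Abs_l2_star l) k))\<^sup>2) \<le> r / 4"
        by (rule sqrt_infsum_le) (use M[OF that] in \<open>simp only: coord_simps cl\<close>)
      then show ?thesis
        using norm_le_usual[of "X n - Abs_l2_star l"] \<open>0 < r\<close> by (simp add: dist_norm)
    qed
    then show "\<exists>no. \<forall>n\<ge>no. dist (X n) (Abs_l2_star l) < r" by blast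
  qed
  then show "convergent X" by (rule convergentI)
qed

lemma vector_space_scaleC: "vector_space scaleC"
  by standard (auto intro!: l2_star_eqI simp: algebra_simps)

text \<open>The type \<open>l2_star \<Rightarrow>\<^sub>L l2_star\<close> consists of the bounded \<^emph>\<open>real\<close>-linear
  operators; the bounded operators on the complex space are its complex-linear members.\<close>

abbreviation clinear :: "(l2_star \<Rightarrow> l2_star) \<Rightarrow> bool"
  where "clinear \<equiv> Vector_Spaces.linear scaleC scaleC"

lift_definition scalar_op :: "complex \<Rightarrow> l2_star \<Rightarrow>\<^sub>L l2_star" is "\<lambda>c x. c *\<^sub>C x"
proof -
  fix c
  show "bounded_linear (\<lambda>x. c *\<^sub>C x)"
    by (rule bounded_linear_intro[where K = "cmod c"])
      (auto intro!: l2_star_eqI simp: algebra_simps norm_scaleC)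
qed

definition is_bounded_inverse :: "l2_star \<Rightarrow>\<^sub>L l2_star \<Rightarrow> l2_star \<Rightarrow>\<^sub>L l2_star \<Rightarrow> bool"
  where "is_bounded_inverse A R \<longleftrightarrow>
    clinear (blinfun_apply R) \<and> A o\<^sub>L R = id_blinfun \<and> R o\<^sub>L A = id_blinfun"

definition op_invertible :: "l2_star \<Rightarrow>\<^sub>L l2_star \<Rightarrow> bool"
  where "op_invertible A \<longleftrightarrow> (\<exists>R. is_bounded_inverse A R)"

definition op_inverse :: "l2_star \<Rightarrow>\<^sub>L l2_star \<Rightarrow> l2_star \<Rightarrow>\<^sub>L l2_star"
  where "op_inverse A = (THE R. is_bounded_inverse A R)"

lemma is_bounded_inverse_unique:
  assumes "is_bounded_inverse A R" "is_bounded_inverse A S"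
  shows "R = S"
proof -
  have "A (S x) = x" "R (A y) = y" for x y
    using assms unfolding is_bounded_inverse_def
    by (metis blinfun_apply_blinfun_compose blinfun_apply_id_blinfun id_apply)+
  then show ?thesis by (metis blinfun_eqI)
qed

lemma op_inverse_eq: "is_bounded_inverse A R \<Longrightarrow> op_inverse A = R"
  unfolding op_inverse_def using is_bounded_inverse_unique by blast

definition resolvent_set :: "l2_star \<Rightarrow>\<^sub>L l2_star \<Rightarrow> complex set"
  where "resolvent_set B = {z. op_invertible (B - scalar_op z)}"

end

theory Submission imports Defs begin

text \<open>The inverse \<open>A\<close> of \<open>B\<close> is the right shift \<open>e\<^sub>k \<mapsto> e\<^sub>k\<^sub>+\<^sub>1\<close>, except that \<open>e\<^sub>0 \<mapsto> 5 e\<^sub>1\<close>. Every vector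
  splits as \<open>x = x\<^sub>0 e\<^sub>0 + y\<close> with \<open>\<parallel>x\<parallel> = \<bar>x\<^sub>0\<bar> + \<parallel>y\<parallel>\<close>, so it suffices to bound the resolvent
  \<open>R = A + zA\<^sup>2 + \<dots>\<close> on the two parts. On \<open>y\<close> the norm of \<open>A\<close> is at most \<open>4\<close>, which leaves room for a
  perturbation by small \<open>z\<close>. The vector \<open>R e\<^sub>0 = 5 e\<^sub>1 + 5 z e\<^sub>2 + \<dots>\<close> has norm exactly \<open>5\<close>: its \<open>0\<close>th
  coordinate vanishes, its first coordinate does not depend on \<open>z\<close>, and the small tail is absorbed by
  the maximum. Hence \<open>\<parallel>R\<parallel> = 5\<close> for all small \<open>z\<close>.\<close>

section \<open>Inversion of I - zA for small z\<close>

lemma clinear_iff: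
  "clinear f \<longleftrightarrow> (\<forall>x y. f (x + y) = f x + f y) \<and> (\<forall>c x. f (c *\<^sub>C x) = c *\<^sub>C f x)"
  by (simp add: Vector_Spaces.linear_iff vector_space_scaleC)

lemma scaleC_distribs:
  "c *\<^sub>C (x + y) = c *\<^sub>C x + c *\<^sub>C y" "c *\<^sub>C (x - y) = c *\<^sub>C x - c *\<^sub>C y"
  "c *\<^sub>C d *\<^sub>C x = d *\<^sub>C c *\<^sub>C x"
  by (auto intro!: l2_star_eqI simp: algebra_simps)

lemma scalar_op_apply [simp]: "blinfun_apply (scalar_op c) x = c *\<^sub>C x"
  by (simp add: scalar_op.rep_eq)

lemma fixed_point_ex1:
  fixes A :: "l2_star \<Rightarrow>\<^sub>L l2_star"
  assumes "cmod z * norm A < 1"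
  shows "\<exists>!s. y + z *\<^sub>C A s = s"
proof (rule banach_fix_type)
  show "\<forall>s t. dist (y + z *\<^sub>C A s) (y + z *\<^sub>C A t) \<le> cmod z * norm A * dist s t"
    by (auto simp: dist_norm norm_scaleC mult.assoc simp flip: scaleC_distribs blinfun.diff_right
        intro!: mult_left_mono norm_blinfun)
qed (use assms in auto)

text \<open>\<open>S\<close> is the inverse of I - zA, found as the fixed point of s |-> y + zAs
  instead of summing the Neumann series. The contraction factor is at most 1/2, whence the bound
  2.\<close>

lemma resolvent_exists:
  fixes A :: "l2_star \<Rightarrow>\<^sub>L l2_star"
  assumes A: "clinear A" and z: "cmod z * norm A \<le> 1 / 2"
  obtains S :: "l2_star \<Rightarrow>\<^sub>L l2_star" where "clinear S" "\<And>y. S y = y + z *\<^sub>C A (S y)"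
    "\<And>y s. s = y + z *\<^sub>C A s \<Longrightarrow> S y = s" "\<And>y. norm (S y) \<le> 2 * norm y"
proof -
  from z have ex1: "\<exists>!s. y + z *\<^sub>C A s = s" for y
    by (intro fixed_point_ex1) simp
  then obtain S where S: "\<And>y. S y = y + z *\<^sub>C A (S y)"
    by metis
  have uniq: "S y = s" if "s = y + z *\<^sub>C A s" for s y
    using ex1[of y] S[of y] that by metis
  \<comment> \<open>Linearity comes from uniqueness: the sum, and below the multiple, solves the
    right fixed point equation.\<close>
  have add: "S (x + y) = S x + S y" for x y
  proof (rule uniq)
    have "S x + S y = (x + z *\<^sub>C A (S x)) + (y + z *\<^sub>C A (S y))"
      using S[of x] S[of y] by simp
    also have "\<dots> = x + y + z *\<^sub>C A (S x + S y)"
      by (simp only: blinfun.add_right scaleC_distribs add_ac)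
    finally show "S x + S y = x + y + z *\<^sub>C A (S x + S y)" .
  qed
  have scale: "S (c *\<^sub>C x) = c *\<^sub>C S x" for c x
  proof (rule uniq)
    have "c *\<^sub>C S x = c *\<^sub>C (x + z *\<^sub>C A (S x))"
      using S[of x] by simp
    also have "\<dots> = c *\<^sub>C x + z *\<^sub>C A (c *\<^sub>C S x)"
      using A by (simp add: clinear_iff scaleC_distribs)
    finally show "c *\<^sub>C S x = c *\<^sub>C x + z *\<^sub>C A (c *\<^sub>C S x)" .
  qed
  have bound: "norm (S y) \<le> 2 * norm y" for y
  proof -
    have "norm (S y) \<le> norm y + norm (z *\<^sub>C A (S y))"
      using S[of y] norm_triangle_ineq[of y "z *\<^sub>C A (S y)"] by simp
    also have "norm (z *\<^sub>C A (S y)) \<le> cmod z * (norm A * norm (S y))"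
      by (simp add: norm_scaleC mult_left_mono norm_blinfun)
    also have "\<dots> \<le> 1 / 2 * norm (S y)"
      using mult_right_mono[OF z, of "norm (S y)"] by (simp add: mult.assoc)
    finally show ?thesis by simp
  qed
  have "bounded_linear S"
  proof (rule bounded_linear_intro)
    show "norm (S x) \<le> norm x * 2" for x
      using bound[of x] by simp
  qed (simp_all add: add scale scaleR_l2_star_def)
  then have apply_S: "blinfun_apply (Blinfun S) = S"
    by (simp add: bounded_linear_Blinfun_apply)
  show thesis
    by (rule that[of "Blinfun S"]) (use S uniq bound add scale in \<open>simp_all add: apply_S clinear_iff\<close>)
qed

section \<open>Splitting off e_0; the weighted shift and its inverse\<close>

lemma norm_split_coord_0:
  assumes "coord y 0 = 0" "\<And>k. k \<noteq> 0 \<Longrightarrow> coord y k = coord x k"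
  shows "norm x = cmod (coord x 0) + norm y"
proof -
  have "(\<Sum>\<^sub>\<infinity>k\<in>- {0, 1}. (cmod (coord y k))\<^sup>2) = (\<Sum>\<^sub>\<infinity>k\<in>- {0, 1}. (cmod (coord x k))\<^sup>2)"
    by (rule infsum_cong) (simp add: assms(2))
  then show ?thesis
    by (simp add: norm_l2_star_def assms)
qed

lift_definition shift :: "int \<Rightarrow> l2_star \<Rightarrow> l2_star" is "\<lambda>j x k. x (k - j)"
proof -
  fix j :: int and x :: "int \<Rightarrow> complex"
  assume "(\<lambda>k. (cmod (x k))\<^sup>2) summable_on UNIV"
  moreover have "bij_betw (\<lambda>k. k - j) UNIV UNIV"
    by (rule bij_betwI[of _ _ _ "\<lambda>k. k + j"]) auto
  ultimately show "(\<lambda>k. (cmod (x (k - j)))\<^sup>2) summable_on UNIV"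
    using summable_on_reindex_bij_betw[of "\<lambda>k. k - j" UNIV UNIV "\<lambda>k. (cmod (x k))\<^sup>2"] by simp
qed

lift_definition unit_vec :: "int \<Rightarrow> l2_star" is "\<lambda>j k. if k = j then 1 else 0"
proof -
  fix j :: int
  have "(\<lambda>k. (cmod (if k = j then 1 else 0))\<^sup>2) summable_on {j} \<longleftrightarrow>
      (\<lambda>k. (cmod (if k = j then 1 else 0))\<^sup>2) summable_on UNIV"
    by (rule summable_on_cong_neutral) auto
  then show "(\<lambda>k. (cmod (if k = j then 1 else 0))\<^sup>2) summable_on UNIV"
    by simp
qed

lemma coord_shift [simp]: "coord (shift j x) k = coord x (k - j)"
  by (simp add: shift.rep_eq)

lemma coord_unit_vec [simp]: "coord (unit_vec j) k = (if k = j then 1 else 0)"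
  by (simp add: unit_vec.rep_eq)

text \<open>The shift preserves the usual norm, and passing to that norm and back costs a factor 2
  each way. What matters later is that 4 < 5.\<close>

lemma norm_shift_le: "norm (shift j x) \<le> 4 * norm x"
proof -
  have "bij_betw (\<lambda>k. k - j) UNIV UNIV"
    by (rule bij_betwI[of _ _ _ "\<lambda>k. k + j"]) auto
  then have "(\<Sum>\<^sub>\<infinity>k. (cmod (coord (shift j x) k))\<^sup>2) = (\<Sum>\<^sub>\<infinity>k. (cmod (coord x k))\<^sup>2)"
    using infsum_reindex_bij_betw[of "\<lambda>k. k - j" UNIV UNIV "\<lambda>k. (cmod (coord x k))\<^sup>2"] by simp
  then show ?thesis
    using norm_le_usual[of "shift j x"] usual_le_norm[of x] by simp
qed

lemma norm_unit_vec_0: "norm (unit_vec 0) = 1"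
  using norm_split_coord_0[of 0 "unit_vec 0"] by simp

lemma norm_unit_vec_1: "norm (unit_vec 1) = 1"
proof -
  have "(\<Sum>\<^sub>\<infinity>k\<in>- {0, 1}. (cmod (coord (unit_vec 1) k))\<^sup>2) = 0"
    by (rule infsum_0) auto
  then show ?thesis
    by (simp add: norm_l2_star_def)
qed

text \<open>This is A. The shift already sends e_0 to e_1, so 4 more copies of e_1 give weight 5.
  The bound 8 = 4 + 4 is crude and serves only boundedness.\<close>

lift_definition heavy_shift :: "l2_star \<Rightarrow>\<^sub>L l2_star"
  is "\<lambda>x. shift 1 x + (4 * coord x 0) *\<^sub>C unit_vec 1"
proof (rule bounded_linear_intro)
  fix x
  have "norm (shift 1 x + (4 * coord x 0) *\<^sub>C unit_vec 1)
      \<le> norm (shift 1 x) + norm ((4 * coord x 0) *\<^sub>C unit_vec 1)"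
    by (rule norm_triangle_ineq)
  also have "\<dots> \<le> norm x * 8"
    using norm_shift_le[of 1 x] coord_le_norm[of x 0]
    by (simp add: norm_scaleC norm_mult norm_unit_vec_1)
  finally show "norm (shift 1 x + (4 * coord x 0) *\<^sub>C unit_vec 1) \<le> norm x * 8" .
qed (auto intro!: l2_star_eqI simp: algebra_simps)

text \<open>This is B. The correction leaves the weight 1 - 4/5 = 1/5 on e_1 |-> e_0, undoing the
  5.\<close>

lift_definition heavy_shift_inv :: "l2_star \<Rightarrow>\<^sub>L l2_star"
  is "\<lambda>x. shift (- 1) x - (4 / 5 * coord x 1) *\<^sub>C unit_vec 0"
proof (rule bounded_linear_intro)
  fix x
  have "norm (shift (- 1) x - (4 / 5 * coord x 1) *\<^sub>C unit_vec 0)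
      \<le> norm (shift (- 1) x) + norm ((4 / 5 * coord x 1) *\<^sub>C unit_vec 0)"
    by (rule norm_triangle_ineq4)
  also have "\<dots> \<le> norm x * 5"
    using norm_shift_le[of "- 1" x] coord_le_norm[of x 1]
    by (simp add: norm_scaleC norm_mult norm_unit_vec_0 norm_divide) (use norm_ge_zero[of x] in linarith)
  finally show "norm (shift (- 1) x - (4 / 5 * coord x 1) *\<^sub>C unit_vec 0) \<le> norm x * 5" .
qed (auto intro!: l2_star_eqI simp: algebra_simps)

lemma coord_heavy_shift [simp]:
  "coord (heavy_shift x) k = (if k = 1 then 5 else 1) * coord x (k - 1)"
  by (simp add: heavy_shift.rep_eq)

lemma coord_heavy_shift_inv [simp]:
  "coord (heavy_shift_inv x) k = (if k = 0 then 1 / 5 else 1) * coord x (k + 1)"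
  by (simp add: heavy_shift_inv.rep_eq)

lemma clinear_heavy_shift: "clinear heavy_shift"
  by (auto simp: clinear_iff algebra_simps intro!: l2_star_eqI)

lemma clinear_heavy_shift_inv: "clinear heavy_shift_inv"
  by (auto simp: clinear_iff algebra_simps intro!: l2_star_eqI)

lemma heavy_shift_inv_cancel [simp]:
  "heavy_shift (heavy_shift_inv x) = x" "heavy_shift_inv (heavy_shift x) = x"
  by (auto intro!: l2_star_eqI)

text \<open>Such a \<open>y\<close> never meets the weight 5. The gap between 4 and 5 will absorb
  the terms in z of the resolvent.\<close>

lemma norm_heavy_shift_le_4:
  assumes "coord y 0 = 0"
  shows "norm (heavy_shift y) \<le> 4 * norm y"
proof -
  have "heavy_shift y = shift 1 y"
    using assms by (auto intro!: l2_star_eqI)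
  then show ?thesis
    by (simp add: norm_shift_le)
qed

text \<open>The norm is the sum of the norms of the two parts, so bounds by \<open>K\<close> on each
  part combine to the same \<open>K\<close>.\<close>

lemma norm_bound_from_split:
  fixes T :: "l2_star \<Rightarrow>\<^sub>L l2_star"
  assumes T: "clinear T" and e: "norm (T (unit_vec 0)) \<le> K"
    and y: "\<And>y. coord y 0 = 0 \<Longrightarrow> norm (T y) \<le> K * norm y"
  shows "norm T \<le> K"
proof (rule norm_blinfun_bound)
  show "0 \<le> K"
    using e norm_ge_zero order_trans by blast
  fix x
  define y where "y = x - coord x 0 *\<^sub>C unit_vec 0"
  have y0: "coord y 0 = 0"
    by (simp add: y_def)
  have "x = coord x 0 *\<^sub>C unit_vec 0 + y"
    by (simp add: y_def)
  then have "T x = coord x 0 *\<^sub>C T (unit_vec 0) + T y"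
    using T by (metis clinear_iff)
  then have "norm (T x) \<le> cmod (coord x 0) * norm (T (unit_vec 0)) + norm (T y)"
    using norm_triangle_ineq[of "coord x 0 *\<^sub>C T (unit_vec 0)" "T y"] by (simp add: norm_scaleC)
  also have "\<dots> \<le> cmod (coord x 0) * K + K * norm y"
    using e y[OF y0] by (intro add_mono mult_left_mono) auto
  also have "\<dots> = K * norm x"
    using norm_split_coord_0[OF y0, of x] by (simp add: y_def algebra_simps)
  finally show "norm (T x) \<le> K * norm x" .
qed

section \<open>Norm of the weighted shift and the resolvent near 0\<close>

lemma heavy_shift_unit_vec_0: "heavy_shift (unit_vec 0) = 5 *\<^sub>C unit_vec 1"
  by (auto intro!: l2_star_eqI)

lemma norm_heavy_shift_le: "norm heavy_shift \<le> 5"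
proof (rule norm_bound_from_split[OF clinear_heavy_shift])
  show "norm (heavy_shift (unit_vec 0)) \<le> 5"
    by (simp add: heavy_shift_unit_vec_0 norm_scaleC norm_unit_vec_1)
  show "norm (heavy_shift y) \<le> 5 * norm y" if "coord y 0 = 0" for y
    using norm_heavy_shift_le_4[OF that] norm_ge_zero[of y] by linarith
qed

lemma norm_heavy_shift_apply: "norm (heavy_shift x) \<le> 5 * norm x"
  using norm_blinfun[of heavy_shift x] mult_right_mono[OF norm_heavy_shift_le, of "norm x"] by simp

text \<open>Moving n places left gains a factor z^n, while all coordinates stay below
  \<open>norm x\<close>. As \<open>S\<close> is known only through its fixed point equation, this is
  how the coordinates of S e_0 left of 0 are seen to vanish.\<close>

lemma coord_eq_0_if_backward_decay:
  assumes z: "cmod z < 1" and rec: "\<And>k. k < 0 \<Longrightarrow> coord x k = z * coord x (k - 1)" and "k < 0"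
  shows "coord x k = 0"
proof -
  have iter: "coord x k = z ^ n * coord x (k - int n)" for n
  proof (induction n)
    case (Suc n)
    have "coord x (k - int n) = z * coord x (k - int n - 1)"
      using \<open>k < 0\<close> by (intro rec) simp
    with Suc show ?case
      by (simp add: algebra_simps)
  qed simp
  have "(\<lambda>n. cmod z ^ n * norm x) \<longlonglongrightarrow> 0"
    using z by (intro tendsto_mult_left_zero LIMSEQ_power_zero) simp
  moreover have "cmod (coord x k) \<le> cmod z ^ n * norm x" for n
    using iter[of n] coord_le_norm[of x "k - int n"]
    by (simp add: norm_mult norm_power mult_left_mono)
  ultimately have "cmod (coord x k) \<le> 0"
    using LIMSEQ_le_const by blast
  then show ?thesis
    by simp
qed

lemma resolvent_heavy_shift_inv:
  assumes z: "cmod z < 1 / 50"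
  obtains R where "is_bounded_inverse (heavy_shift_inv - scalar_op z) R" "norm R = 5"
proof -
  let ?A = heavy_shift
  have small: "cmod z * norm ?A \<le> 1 / 2"
    using mult_mono[of "cmod z" "1 / 50" "norm ?A" 5] norm_heavy_shift_le z by simp
  obtain S :: "l2_star \<Rightarrow>\<^sub>L l2_star" where cl: "clinear S" and S: "\<And>y. S y = y + z *\<^sub>C ?A (S y)"
    and uniq: "\<And>y s. s = y + z *\<^sub>C ?A s \<Longrightarrow> S y = s" and S_le: "\<And>y. norm (S y) \<le> 2 * norm y"
    using resolvent_exists[OF clinear_heavy_shift small] by blast
  \<comment> \<open>B - zI = (I - zA)B, so the inverse is AS.\<close>
  define R where "R = ?A o\<^sub>L S"
  have R_apply: "R y = ?A (S y)" for y
    by (simp add: R_def)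
  have cl_R: "clinear R"
    using cl clinear_heavy_shift by (simp add: clinear_iff R_apply)
  have inv: "is_bounded_inverse (heavy_shift_inv - scalar_op z) R"
    unfolding is_bounded_inverse_def
  proof (intro conjI cl_R blinfun_eqI)
    fix y
    show "((heavy_shift_inv - scalar_op z) o\<^sub>L R) y = id_blinfun y"
      using S[of y] by (simp add: blinfun.diff_left R_apply algebra_simps)
    \<comment> \<open>For s = By one has As = y, hence s = (By - zy) + zAs.\<close>
    have "S (heavy_shift_inv y - z *\<^sub>C y) = heavy_shift_inv y"
      by (rule uniq) simp
    then show "(R o\<^sub>L (heavy_shift_inv - scalar_op z)) y = id_blinfun y"
      by (simp add: blinfun.diff_left R_apply)
  qed
  \<comment> \<open>\<open>Q\<close> is the part of the resolvent beyond its leading term A.\<close>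
  define Q where "Q y = z *\<^sub>C ?A (?A (S y))" for y
  have R_split: "R y = ?A y + Q y" for y
  proof -
    have "R y = ?A (y + z *\<^sub>C ?A (S y))"
      using S[of y] by (simp add: R_apply)
    then show ?thesis
      using clinear_heavy_shift by (simp add: clinear_iff Q_def)
  qed
  \<comment> \<open>The radius 1/50 comes from here: A twice costs 5 * 5 and \<open>S\<close> costs
    2.\<close>
  have Q_le: "norm (Q y) \<le> norm y" for y
  proof -
    have "norm (?A (?A (S y))) \<le> 50 * norm y"
      using norm_heavy_shift_apply[of "?A (S y)"] norm_heavy_shift_apply[of "S y"] S_le[of y]
      by linarith
    then have "norm (Q y) \<le> 1 / 50 * (50 * norm y)"
      unfolding Q_def norm_scaleC using z by (intro mult_mono) auto
    then show ?thesis
      by simp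
  qed
  define x where "x = S (unit_vec 0)"
  \<comment> \<open>Coordinates of x = e_0 + zAx; left of 0 this is the backward recursion.\<close>
  have x: "coord x k = (if k = 0 then 1 else 0) + z * ((if k = 1 then 5 else 1) * coord x (k - 1))" for k
    using arg_cong[OF S[of "unit_vec 0"], of "\<lambda>v. coord v k"] by (simp add: x_def)
  have x_neg: "coord x (- 1) = 0"
  proof (rule coord_eq_0_if_backward_decay)
    show "coord x k = z * coord x (k - 1)" if "k < 0" for k
      using x[of k] that by simp
  qed (use z in auto)
  have x_0: "coord x 0 = 1"
    using x[of 0] x_neg by simp
  \<comment> \<open>Since R e_0 = Ax, these are the coordinate of \<open>x\<close> at -1 and 5 times
    that at 0, both free of z.\<close>
  have Re_0: "coord (R (unit_vec 0)) 0 = 0" and Re_1: "coord (R (unit_vec 0)) 1 = 5"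
    using x_neg x_0 by (simp_all add: R_apply flip: x_def)
  \<comment> \<open>A e_0 = 5 e_1 vanishes outside {0, 1}, so only Q e_0, of norm at most 1, is left
    there.\<close>
  have tail: "sqrt (\<Sum>\<^sub>\<infinity>k\<in>- {0, 1}. (cmod (coord (R (unit_vec 0)) k))\<^sup>2) \<le> 5"
  proof -
    have "(\<Sum>\<^sub>\<infinity>k\<in>- {0, 1}. (cmod (coord (R (unit_vec 0)) k))\<^sup>2)
        = (\<Sum>\<^sub>\<infinity>k\<in>- {0, 1}. (cmod (coord (Q (unit_vec 0)) k))\<^sup>2)"
      by (rule infsum_cong) (simp add: R_split heavy_shift_unit_vec_0)
    also have "sqrt \<dots> \<le> norm (Q (unit_vec 0))"
      unfolding norm_l2_star_def using norm_ge_zero[of "coord (Q (unit_vec 0)) 0"] by linarith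
    finally show ?thesis
      using Q_le[of "unit_vec 0"] by (simp add: norm_unit_vec_0)
  qed
  have Re: "norm (R (unit_vec 0)) = 5"
    using tail by (simp add: norm_l2_star_def[of "R (unit_vec 0)"] Re_0 Re_1)
  have "norm R \<le> 5"
  proof (rule norm_bound_from_split[OF cl_R])
    \<comment> \<open>A contributes 4 and \<open>Q\<close> contributes 1, which stays within the
      value 5 attained at e_0.\<close>
    show "norm (R y) \<le> 5 * norm y" if "coord y 0 = 0" for y
      using norm_triangle_ineq[of "?A y" "Q y"] norm_heavy_shift_le_4[OF that] Q_le[of y]
      by (simp add: R_split)
  qed (simp add: Re)
  moreover have "5 \<le> norm R"
    using norm_blinfun[of R "unit_vec 0"] by (simp add: Re norm_unit_vec_0)
  ultimately show thesis
    using inv that by simp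
qed

theorem theorem2p4:
  "\<exists>B :: l2_star \<Rightarrow>\<^sub>L l2_star.
     clinear (blinfun_apply B) \<and> op_invertible B \<and>
     (\<exists>U :: complex set. open U \<and> 0 \<in> U \<and> U \<subseteq> resolvent_set B \<and>
        (\<lambda>z. norm (op_inverse (B - scalar_op z))) constant_on U)"
proof (intro exI conjI)
  show "clinear heavy_shift_inv"
    by (rule clinear_heavy_shift_inv)
  show "op_invertible heavy_shift_inv"
    unfolding op_invertible_def is_bounded_inverse_def
    by (intro exI[of _ heavy_shift] conjI clinear_heavy_shift blinfun_eqI) simp_all
  show "open (ball 0 (1 / 50) :: complex set)" "0 \<in> (ball 0 (1 / 50) :: complex set)"
    by simp_all
  show "ball 0 (1 / 50) \<subseteq> resolvent_set heavy_shift_inv"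
    using resolvent_heavy_shift_inv by (force simp: resolvent_set_def op_invertible_def)
  have "norm (op_inverse (heavy_shift_inv - scalar_op z)) = 5" if "z \<in> ball 0 (1 / 50)" for z
    using resolvent_heavy_shift_inv[of z] that op_inverse_eq by (metis mem_ball_0)
  then show "(\<lambda>z. norm (op_inverse (heavy_shift_inv - scalar_op z))) constant_on ball 0 (1 / 50)"
    unfolding constant_on_def by blast
qed

end
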